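(* Let $q$ be generic, let $\mathbb K_q[\mathbb R^3]$ be the algebra with generators $b,h,c$ defined in the context, and let $B_q,H_q,C_q$ be the extended adjoint operators on $\mathbb K_q[\mathbb R^3]$ defined in the context. Then these operators obey the relation $$q^{-1}\,b\,C_q+\frac{h\,H_q}{2_q}+q\,c\,B_q=0,$$ that is, $q^{-1}b\cdot C_q(f)+\frac1{2_q}h\cdot H_q(f)+q\,c\cdot B_q(f)=0$ for all $f\in\mathbb K_q[\mathbb R^3]$.
   Context: $\mathbb K$ is $\mathbb R$ or $\mathbb C$; $q\in\mathbb K\setminus\{0\}$; $2_q=q+q^{-1}\ne0$. Let $\mathcal{SL}$ be the vector space with basis $\{b,h,c\}$ and $$I_-=\mathrm{span}\big(q^2h\otimes b-b\otimes h,\ q^2c\otimes h-h\otimes c,\ 2_q\,q\,(b\otimes c-c\otimes b)+(q^2-1)h\otimes h\big)\subset\mathcal{SL}^{\otimes2},$$ $$I_+=\mathrm{span}\big(q^{-1}b\otimes c+\tfrac1{2_q}h\otimes h+q\,c\otimes b,\ b\otimes b,\ q^2b\otimes h+h\otimes b,\ q^3b\otimes c-q\,h\otimes h+q^{-1}c\otimes b,\ q^2h\otimes c+c\otimes h,\ c\otimes c\big).$$ The algebra is $\mathbb K_q[\mathbb R^3]=T(\mathcal{SL})/\langle I_-\rangle$, i.e. it is generated by $b,h,c$ subject to $q^2hb=bh$, $q^2ch=hc$, $2_q\,q\,(bc-cb)+(q^2-1)h^2=0$. It is graded, with degree $n$ component $\mathcal{SL}^{\otimes n}/I_-^{\cup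 n}$. For a subspace $J\subset\mathcal{SL}^{\otimes2}$ and $m\ge2$ put $J^{\cap m}=\bigcap_{k=0}^{m-2}\mathcal{SL}^{\otimes k}\otimes J\otimes\mathcal{SL}^{\otimes(m-2-k)}$ and $J^{\cup m}=\sum_{k=0}^{m-2}\mathcal{SL}^{\otimes k}\otimes J\otimes\mathcal{SL}^{\otimes(m-2-k)}$; also $J^{\cap1}=\mathcal{SL}$, $J^{\cap 0}=\mathbb K$. The couple $(I_-,I_+)$ is called regular if for all $m\geq2$ one has $\mathcal{SL}^{\otimes m}=I_-^{\cup m}\oplus I_+^{\cap m}$ and $\mathcal{SL}^{\otimes m}=I_+^{\cup m}\oplus I_-^{\cap m}$. Standing assumption: $q$ is generic in the sense that $(I_-,I_+)$ is regular. Then each homogeneous $f$ of degree $n$ has a unique representative in $I_+^{\cap n}\subset\mathcal{SL}^{\otimes n}$, called its canonical form. Let $w\in\mathbb K$, $w\neq0$, and let $[\,,\,]:\mathcal{SL}\otimes\mathcal{SL}\to\mathcal{SL}$ be the bilinear bracket $$[b,b]=0,\ [b,h]=-w\,b,\ [b,c]=w\tfrac{q}{2_q}h,\ [h,b]=wq^2b,\ [h,h]=w(q^2-1)h,\ [h,c]=-w\,c,\ [c,b]=-w\tfrac q{2_q}h,\ [c,h]=wq^2c,\ [c,c]=0.$$ On $\mathcal{SL}$ put $B_q(y)=[b,y]$, $H_q(y)=[h,y]$, $C_q(y)=[c,y]$. These operators are extended to $\mathbb K_q[\mathbb R^3]$ as follows: for $f$ homogeneous of degree $n$ written in canonical form,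 $$B_q(f)=n\,(B_q)_1(f),\qquad H_q(f)=n\,(H_q)_1(f),\qquad C_q(f)=n\,(C_q)_1(f),$$ where the subscript $1$ means that the operator is applied to the first tensor factor and the result is then taken as an element of $\mathbb K_q[\mathbb R^3]$ (so constants are sent to $0$); they are extended to all of $\mathbb K_q[\mathbb R^3]$ by linearity. *)

theory Defs
  imports "HOL-Analysis.Analysis" "HOL-Library.Poly_Mapping" "HOL-Algebra.QuotRing"
begin

datatype gen = Gb | Gh | Gc

datatype wrd = Wrd (letters: "gen list")

instantiation wrd :: monoid_add
begin

definition zero_wrd :: wrd where "0 = Wrd []"

definition plus_wrd :: "wrd \<Rightarrow> wrd \<Rightarrow> wrd" where
  "u + v = Wrd (letters u @ letters v)"

instance
  by standard (simp_all add: zero_wrd_def plus_wrd_def)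

end

text \<open>
  The free monoid on the three letters is written additively, so that the convolution product of
  \<^typ>\<open>wrd \<Rightarrow>\<^sub>0 'a\<close> is concatenation of words: this type is the tensor algebra
  of the vector space with basis \<open>b, h, c\<close>, and \<open>s * t\<close> is the tensor product of
  \<open>s\<close> and \<open>t\<close>.
\<close>

type_synonym 'a tensor = "wrd \<Rightarrow>\<^sub>0 'a"

definition tscale :: "'a::field \<Rightarrow> 'a tensor \<Rightarrow> 'a tensor" where
  "tscale a t = Poly_Mapping.map ((*) a) t"

lemma lookup_tscale [simp]:
  "Poly_Mapping.lookup (tscale a t) u = a * Poly_Mapping.lookup t u"
  by (simp add: tscale_def Poly_Mapping.map.rep_eq when_def)

interpretation tensor: vector_space "tscale :: 'a::field \<Rightarrow> 'a tensor \<Rightarrow> 'a tensor"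
  by unfold_locales (auto intro!: poly_mapping_eqI simp: lookup_add algebra_simps)

definition gen_tensor :: "gen \<Rightarrow> 'a::field tensor" where
  "gen_tensor x = Poly_Mapping.single (Wrd [x]) 1"

abbreviation tb :: "'a::field tensor" where "tb \<equiv> gen_tensor Gb"
abbreviation th :: "'a::field tensor" where "th \<equiv> gen_tensor Gh"
abbreviation tc :: "'a::field tensor" where "tc \<equiv> gen_tensor Gc"

definition tensor_power :: "nat \<Rightarrow> 'a::field tensor set" where
  "tensor_power n = tensor.span {Poly_Mapping.single (Wrd xs) 1 | xs. length xs = n}"

definition tensor_part :: "nat \<Rightarrow> 'a::field tensor \<Rightarrow> 'a tensor" where
  "tensor_part n t =
     (\<Sum>u | u \<in> Poly_Mapping.keys t \<and> length (letters u) = n.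
        Poly_Mapping.single u (Poly_Mapping.lookup t u))"

text \<open>
  The definitions below make sense over any field. The intended ground fields are the reals and
  the complex numbers; up to isomorphism these are exactly the instances of the class
  \<^class>\<open>real_normed_field\<close> (Gelfand--Mazur).
\<close>

definition qtwo :: "'a::field \<Rightarrow> 'a" where
  "qtwo q = q + inverse q"

definition I_minus :: "'a::field \<Rightarrow> 'a tensor set" where
  "I_minus q = tensor.span
     {tscale (q^2) (th * tb) - tb * th,
      tscale (q^2) (tc * th) - th * tc,
      tscale (qtwo q * q) (tb * tc - tc * tb) + tscale (q^2 - 1) (th * th)}"

definition I_plus :: "'a::field \<Rightarrow> 'a tensor set" where
  "I_plus q = tensor.span
     {tscale (inverse q) (tb * tc) + tscale (1 / qtwo q) (th * th) + tscale q (tc * tb),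
      tb * tb,
      tscale (q^2) (tb * th) + th * tb,
      tscale (q^3) (tb * tc) - tscale q (th * th) + tscale (inverse q) (tc * tb),
      tscale (q^2) (th * tc) + tc * th,
      tc * tc}"

definition sandwich :: "'a::field tensor set \<Rightarrow> nat \<Rightarrow> nat \<Rightarrow> 'a tensor set" where
  "sandwich J k l = tensor.span
     {s * j * t | s j t. s \<in> tensor_power k \<and> j \<in> J \<and> t \<in> tensor_power l}"

text \<open>
  In degrees 0 and 1 the intersection is the ground field and the generating space.
\<close>

definition cap_power :: "'a::field tensor set \<Rightarrow> nat \<Rightarrow> 'a tensor set" where
  "cap_power J m =
     (if m < 2 then tensor_power m else (\<Inter>k\<in>{0..m-2}. sandwich J k (m - 2 - k)))"

definition cup_power :: "'a::field tensor set \<Rightarrow> nat \<Rightarrow> 'a tensor set" where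
  "cup_power J m =
     (if m < 2 then {0} else tensor.span (\<Union>k\<in>{0..m-2}. sandwich J k (m - 2 - k)))"

definition is_direct_sum ::
  "'a::field tensor set \<Rightarrow> 'a tensor set \<Rightarrow> 'a tensor set \<Rightarrow> bool" where
  "is_direct_sum V U W \<longleftrightarrow> V = {u + w | u w. u \<in> U \<and> w \<in> W} \<and> U \<inter> W = {0}"

definition regular_couple :: "'a::field tensor set \<Rightarrow> 'a tensor set \<Rightarrow> bool" where
  "regular_couple J K \<longleftrightarrow>
     (\<forall>m\<ge>2. is_direct_sum (tensor_power m) (cup_power J m) (cap_power K m) \<and>
            is_direct_sum (tensor_power m) (cup_power K m) (cap_power J m))"

definition tensor_ring :: "'a::field tensor ring" where
  "tensor_ring = \<lparr>carrier = UNIV, mult = (*), one = 1, zero = 0, add = (+)\<rparr>"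

lemma ring_tensor_ring: "ring (tensor_ring :: 'a::field tensor ring)"
proof (rule ringI)
  show "abelian_group (tensor_ring :: 'a tensor ring)"
  proof (rule abelian_groupI)
    fix x :: "'a tensor"
    show "\<exists>y\<in>carrier tensor_ring. y \<oplus>\<^bsub>tensor_ring\<^esub> x = \<zero>\<^bsub>tensor_ring\<^esub>"
      by (rule bexI[of _ "- x"]) (simp_all add: tensor_ring_def)
  qed (simp_all add: tensor_ring_def add_ac)
  show "monoid (tensor_ring :: 'a tensor ring)"
    by (rule monoidI) (simp_all add: tensor_ring_def mult.assoc)
qed (simp_all add: tensor_ring_def distrib_left distrib_right)

text \<open>
  \<^const>\<open>genideal\<close> generates two-sided ideals; the elements of the quotient
  \<open>qR3 q\<close> are cosets.
\<close>

definition rel_ideal :: "'a::field \<Rightarrow> 'a tensor set" where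
  "rel_ideal q = genideal tensor_ring (I_minus q)"

definition qR3 :: "'a::field \<Rightarrow> 'a tensor set ring" where
  "qR3 q = tensor_ring Quot (rel_ideal q)"

definition qclass :: "'a::field \<Rightarrow> 'a tensor \<Rightarrow> 'a tensor set" where
  "qclass q t = rel_ideal q +>\<^bsub>tensor_ring\<^esub> t"

text \<open>
  The homogeneous component of a coset; the union is over equal cosets because the ideal is
  homogeneous.
\<close>

definition qpart :: "'a::field \<Rightarrow> nat \<Rightarrow> 'a tensor set \<Rightarrow> 'a tensor set" where
  "qpart q n f = (\<Union>t\<in>f. qclass q (tensor_part n t))"

text \<open>Only meaningful for \<open>f\<close> homogeneous of degree \<open>n\<close> and a regular couple.\<close>

definition canonical_form :: "'a::field \<Rightarrow> nat \<Rightarrow> 'a tensor set \<Rightarrow> 'a tensor" where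
  "canonical_form q n f = (THE t. t \<in> cap_power (I_plus q) n \<and> qclass q t = f)"

fun bracket_gen :: "'a::field \<Rightarrow> 'a \<Rightarrow> gen \<Rightarrow> gen \<Rightarrow> 'a tensor" where
  "bracket_gen q w Gb Gb = 0"
| "bracket_gen q w Gb Gh = tscale (- w) tb"
| "bracket_gen q w Gb Gc = tscale (w * (q / qtwo q)) th"
| "bracket_gen q w Gh Gb = tscale (w * q^2) tb"
| "bracket_gen q w Gh Gh = tscale (w * (q^2 - 1)) th"
| "bracket_gen q w Gh Gc = tscale (- w) tc"
| "bracket_gen q w Gc Gb = tscale (- w * (q / qtwo q)) th"
| "bracket_gen q w Gc Gh = tscale (w * q^2) tc"
| "bracket_gen q w Gc Gc = 0"

text \<open>
  The operator \<open>[y, _]\<close>, for a generator \<open>y\<close>, applied to the first tensor factor.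
\<close>

definition ad_first :: "'a::field \<Rightarrow> 'a \<Rightarrow> gen \<Rightarrow> 'a tensor \<Rightarrow> 'a tensor" where
  "ad_first q w y t =
     (\<Sum>u\<in>Poly_Mapping.keys t. tscale (Poly_Mapping.lookup t u)
        (case letters u of
           [] \<Rightarrow> 0
         | x # xs \<Rightarrow> bracket_gen q w y x * Poly_Mapping.single (Wrd xs) 1))"

definition ad_homogeneous ::
  "'a::field \<Rightarrow> 'a \<Rightarrow> gen \<Rightarrow> nat \<Rightarrow> 'a tensor set \<Rightarrow> 'a tensor set" where
  "ad_homogeneous q w y n f =
     qclass q (tscale (of_nat n) (ad_first q w y (canonical_form q n f)))"

definition ad_ext :: "'a::field \<Rightarrow> 'a \<Rightarrow> gen \<Rightarrow> 'a tensor set \<Rightarrow> 'a tensor set" where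
  "ad_ext q w y f =
     (\<Oplus>\<^bsub>qR3 q\<^esub>n\<in>{n. qpart q n f \<noteq> \<zero>\<^bsub>qR3 q\<^esub>}. ad_homogeneous q w y n (qpart q n f))"

definition Bq :: "'a::field \<Rightarrow> 'a \<Rightarrow> 'a tensor set \<Rightarrow> 'a tensor set" where
  "Bq q w = ad_ext q w Gb"

definition Hq :: "'a::field \<Rightarrow> 'a \<Rightarrow> 'a tensor set \<Rightarrow> 'a tensor set" where
  "Hq q w = ad_ext q w Gh"

definition Cq :: "'a::field \<Rightarrow> 'a \<Rightarrow> 'a tensor set \<Rightarrow> 'a tensor set" where
  "Cq q w = ad_ext q w Gc"

end

theory Submission
  imports Defs
begin

text \<open>
  The operator \<open>q\<^sup>-\<^sup>1 b C + h H / 2\<^sub>q + q c B\<close> vanishes on the algebra for a reason that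
  is already visible on tensors. Apply the brackets to the first letter \<open>x\<close> of a word \<open>x v\<close> and
  multiply on the left by the three generators: the result is
  \<open>(q\<^sup>-\<^sup>1 b [c,x] + h [h,x] / 2\<^sub>q + q c [b,x]) v\<close>. The factor in parentheses has degree 2,
  and for \<open>x = b, h, c\<close> it is \<open>w / 2\<^sub>q\<close> times the first, third and second defining relation of
  the algebra, respectively (\<open>casimir_bracket_in_I_minus\<close>). By linearity the
  operator therefore maps every tensor into the ideal of relations
  (\<open>casimir_ad_first_in_rel_ideal\<close>).

  What links this to the operators on the algebra is that, for a given \<open>f\<close>, the three
  extended operators evaluate their brackets on one and the same tensor: the sum over the degrees
  \<open>n\<close> of \<open>n\<close> times the canonical form of the component of \<open>f\<close>
  (\<open>ad_ext_common_representative\<close>).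
\<close>

section \<open>Scalars in the tensor algebra\<close>

text \<open>
  Scalar multiplication is multiplication by a multiple of the empty word, which is central.
\<close>

lemma single_zero_central:
  fixes t :: "'a::field tensor"
  shows "Poly_Mapping.single 0 a * t = t * Poly_Mapping.single 0 a"
proof (induction t rule: update_induct)
  case const
  show ?case by simp
next
  case (update t u c)
  have "Poly_Mapping.update u c t = t + Poly_Mapping.single u c"
    using update.hyps
    by (intro poly_mapping_eqI) (auto simp: lookup_update lookup_add lookup_single in_keys_iff when_def)
  with update.IH show ?case
    by (simp add: mult_single distrib_left distrib_right mult.commute)
qed

lemma tscale_conv_mult: "tscale a t = Poly_Mapping.single 0 a * t"
  unfolding tscale_def by (rule mult_map_scale_conv_mult)

lemma tscale_mult_left: "tscale a s * t = tscale a (s * t)"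
  by (simp add: tscale_conv_mult mult.assoc)

lemma tscale_mult_right: "s * tscale a t = tscale a (s * t)"
  by (metis tscale_conv_mult mult.assoc single_zero_central)

section \<open>The bracket on the first tensor factor\<close>

definition ad_word :: "'a::field \<Rightarrow> 'a \<Rightarrow> gen \<Rightarrow> wrd \<Rightarrow> 'a tensor" where
  "ad_word q w y u = (case letters u of
     [] \<Rightarrow> 0
   | x # xs \<Rightarrow> bracket_gen q w y x * Poly_Mapping.single (Wrd xs) 1)"

lemma ad_first_superset:
  assumes "finite K" and "Poly_Mapping.keys t \<subseteq> K"
  shows "ad_first q w y t =
           (\<Sum>u\<in>K. tscale (Poly_Mapping.lookup t u) (ad_word q w y u))"
  unfolding ad_first_def ad_word_def
  using assms by (intro sum.mono_neutral_left) (auto simp: in_keys_iff)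

lemma ad_first_add: "ad_first q w y (s + t) = ad_first q w y s + ad_first q w y t"
proof -
  let ?K = "Poly_Mapping.keys s \<union> Poly_Mapping.keys t"
  have "Poly_Mapping.keys (s + t) \<subseteq> ?K"
    by (rule keys_add)
  then show ?thesis
    by (simp add: ad_first_superset[of ?K] lookup_add tensor.scale_left_distrib sum.distrib)
qed

lemma ad_first_tscale: "ad_first q w y (tscale a t) = tscale a (ad_first q w y t)"
proof -
  have "Poly_Mapping.keys (tscale a t) \<subseteq> Poly_Mapping.keys t"
    by (auto simp: in_keys_iff)
  then show ?thesis
    by (simp add: ad_first_superset[of "Poly_Mapping.keys t"] tensor.scale_sum_right)
qed

lemma ad_first_zero: "ad_first q w y 0 = 0"
  by (simp add: ad_first_def)

section \<open>The quotient by the ideal of relations\<close>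

lemma ideal_rel_ideal: "ideal (rel_ideal q) tensor_ring"
  unfolding rel_ideal_def
  by (rule ring.genideal_ideal[OF ring_tensor_ring]) (simp add: tensor_ring_def)

lemma I_minus_subset_rel_ideal: "I_minus q \<subseteq> rel_ideal q"
  unfolding rel_ideal_def
  by (rule ring.genideal_self[OF ring_tensor_ring]) (simp add: tensor_ring_def)

lemma rel_ideal_mult_right: "s \<in> rel_ideal q \<Longrightarrow> s * t \<in> rel_ideal q"
  using ideal.I_r_closed[OF ideal_rel_ideal, of s q t] by (simp add: tensor_ring_def)

lemma rel_ideal_mult_left: "s \<in> rel_ideal q \<Longrightarrow> t * s \<in> rel_ideal q"
  using ideal.I_l_closed[OF ideal_rel_ideal, of s q t] by (simp add: tensor_ring_def)

lemma rel_ideal_add: "s \<in> rel_ideal q \<Longrightarrow> t \<in> rel_ideal q \<Longrightarrow> s + t \<in> rel_ideal q"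
  using additive_subgroup.a_closed[OF ideal.axioms(1)[OF ideal_rel_ideal], of s q t]
  by (simp add: tensor_ring_def)

lemma rel_ideal_zero: "0 \<in> rel_ideal q"
  using additive_subgroup.zero_closed[OF ideal.axioms(1)[OF ideal_rel_ideal], of q]
  by (simp add: tensor_ring_def)

lemma rel_ideal_sum: "(\<And>u. u \<in> K \<Longrightarrow> s u \<in> rel_ideal q) \<Longrightarrow> sum s K \<in> rel_ideal q"
  by (induction K rule: infinite_finite_induct) (auto intro: rel_ideal_add rel_ideal_zero)

lemma rel_ideal_tscale: "s \<in> rel_ideal q \<Longrightarrow> tscale a s \<in> rel_ideal q"
  by (simp add: tscale_conv_mult rel_ideal_mult_left)

lemma ring_qR3: "ring (qR3 q)"
  unfolding qR3_def by (rule ideal.quotient_is_ring[OF ideal_rel_ideal])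

lemma qclass_hom: "qclass q \<in> ring_hom tensor_ring (qR3 q)"
  using ideal.rcos_ring_hom[OF ideal_rel_ideal, of q]
  unfolding qR3_def qclass_def[abs_def] .

lemma qclass_closed: "qclass q t \<in> carrier (qR3 q)"
  using ring_hom_closed[OF qclass_hom, of t] by (simp add: tensor_ring_def)

lemma qclass_mult: "qclass q s \<otimes>\<^bsub>qR3 q\<^esub> qclass q t = qclass q (s * t)"
  using ring_hom_mult[OF qclass_hom, of s t] by (simp add: tensor_ring_def)

lemma qclass_add: "qclass q s \<oplus>\<^bsub>qR3 q\<^esub> qclass q t = qclass q (s + t)"
  using ring_hom_add[OF qclass_hom, of s t] by (simp add: tensor_ring_def)

lemma qclass_eq_zero:
  assumes "t \<in> rel_ideal q"
  shows "qclass q t = \<zero>\<^bsub>qR3 q\<^esub>"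
proof -
  interpret ideal "rel_ideal q" tensor_ring by (rule ideal_rel_ideal)
  show ?thesis
    using a_rcos_const[OF assms] by (simp add: qclass_def qR3_def FactRing_def)
qed

lemma qclass_finsum:
  assumes "finite N"
  shows "(\<Oplus>\<^bsub>qR3 q\<^esub>n\<in>N. qclass q (s n)) = qclass q (\<Sum>n\<in>N. s n)"
  using assms
proof (induction N)
  case empty
  interpret ring "qR3 q" by (rule ring_qR3)
  show ?case by (simp add: qclass_eq_zero rel_ideal_zero)
next
  case (insert n N)
  interpret ring "qR3 q" by (rule ring_qR3)
  show ?case
    using insert by (simp add: finsum_insert qclass_closed qclass_add Pi_def)
qed

section \<open>The relation\<close>

text \<open>
  Each generator \<open>x\<close> is bracketed with the second leg of the first spanning tensor of
  \<open>I_plus q\<close>, a quantum analogue of the quadratic Casimir element. A one-line computation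
  for each \<open>x\<close> gives a defining relation, always with the factor \<open>w / 2\<^sub>q\<close>.
\<close>

lemma casimir_bracket_in_I_minus:
  fixes q w :: "'a::field"
  assumes "q \<noteq> 0" and "qtwo q \<noteq> 0"
  shows "tscale (inverse q) (tb * bracket_gen q w Gc x)
       + tscale (1 / qtwo q) (th * bracket_gen q w Gh x)
       + tscale q (tc * bracket_gen q w Gb x) \<in> I_minus q" (is "?E x \<in> _")
proof -
  let ?r1 = "tscale (q^2) (th * tb) - tb * th :: 'a tensor"
  let ?r2 = "tscale (q^2) (tc * th) - th * tc :: 'a tensor"
  let ?r3 = "tscale (qtwo q * q) (tb * tc - tc * tb) + tscale (q^2 - 1) (th * th) :: 'a tensor"
  have mem: "tscale a r \<in> I_minus q" if "r \<in> {?r1, ?r2, ?r3}" for a r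
    unfolding I_minus_def using that by (intro tensor.span_scale tensor.span_base)
  show ?thesis
  proof (cases x)
    case Gb
    have "?E Gb = tscale (w / qtwo q) ?r1"
      by (rule poly_mapping_eqI)
         (simp add: tscale_mult_right lookup_add lookup_minus, use assms in \<open>simp add: field_simps\<close>)
    then show ?thesis using Gb mem by simp
  next
    case Gh
    have "?E Gh = tscale (w / qtwo q) ?r3"
      by (rule poly_mapping_eqI)
         (simp add: tscale_mult_right lookup_add lookup_minus,
          use assms in \<open>simp add: field_simps power2_eq_square\<close>)
    then show ?thesis using Gh mem by simp
  next
    case Gc
    have "?E Gc = tscale (w / qtwo q) ?r2"
      by (rule poly_mapping_eqI)
         (simp add: tscale_mult_right lookup_add lookup_minus,
          use assms in \<open>simp add: field_simps power2_eq_square\<close>)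
    then show ?thesis using Gc mem by simp
  qed
qed

lemma casimir_ad_first_in_rel_ideal:
  fixes q w :: "'a::field"
  assumes "q \<noteq> 0" and "qtwo q \<noteq> 0"
  shows "tscale (inverse q) tb * ad_first q w Gc t
       + tscale (1 / qtwo q) th * ad_first q w Gh t
       + tscale q tc * ad_first q w Gb t \<in> rel_ideal q"
proof -
  let ?E = "\<lambda>u. tscale (inverse q) (tb * ad_word q w Gc u)
       + tscale (1 / qtwo q) (th * ad_word q w Gh u)
       + tscale q (tc * ad_word q w Gb u)"
  have word: "?E u \<in> rel_ideal q" for u
  proof (cases "letters u")
    case Nil
    then show ?thesis by (simp add: ad_word_def rel_ideal_zero)
  next
    case (Cons x xs)
    have "?E u = (tscale (inverse q) (tb * bracket_gen q w Gc x)
        + tscale (1 / qtwo q) (th * bracket_gen q w Gh x)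
        + tscale q (tc * bracket_gen q w Gb x)) * Poly_Mapping.single (Wrd xs) 1"
      by (simp add: ad_word_def Cons distrib_right tscale_mult_left mult.assoc)
    moreover have "\<dots> \<in> rel_ideal q"
      using casimir_bracket_in_I_minus[OF assms] I_minus_subset_rel_ideal
      by (blast intro: rel_ideal_mult_right)
    ultimately show ?thesis by simp
  qed
  have "tscale (inverse q) tb * ad_first q w Gc t
       + tscale (1 / qtwo q) th * ad_first q w Gh t
       + tscale q tc * ad_first q w Gb t
      = (\<Sum>u\<in>Poly_Mapping.keys t. tscale (Poly_Mapping.lookup t u) (?E u))"
    by (simp add: ad_first_superset[OF finite_keys subset_refl] sum_distrib_left
        tscale_mult_left tscale_mult_right tensor.scale_right_distrib sum.distrib
        tensor.scale_left_commute)
  also have "\<dots> \<in> rel_ideal q"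
    by (intro rel_ideal_sum rel_ideal_tscale word)
  finally show ?thesis .
qed

text \<open>
  The representative does not depend on the generator \<open>y\<close>, because the factor \<open>n\<close> and the
  canonical forms do not; the brackets with \<open>b\<close>, \<open>h\<close>, \<open>c\<close> can then be combined on it.
\<close>

lemma ad_ext_common_representative:
  "\<exists>t. \<forall>y. ad_ext q w y f = qclass q (ad_first q w y t)"
proof -
  let ?N = "{n. qpart q n f \<noteq> \<zero>\<^bsub>qR3 q\<^esub>}"
  let ?t = "\<lambda>n. tscale (of_nat n) (canonical_form q n (qpart q n f))"
  interpret ring "qR3 q" by (rule ring_qR3)
  have ad: "ad_ext q w y f = (\<Oplus>\<^bsub>qR3 q\<^esub>n\<in>?N. qclass q (ad_first q w y (?t n)))" for y
    by (simp add: ad_ext_def ad_homogeneous_def ad_first_tscale)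
  show ?thesis
  proof (cases "finite ?N")
    case True
    have "ad_first q w y (\<Sum>n\<in>?N. ?t n) = (\<Sum>n\<in>?N. ad_first q w y (?t n))" for y
      using True by (induction rule: finite_induct) (simp_all add: ad_first_zero ad_first_add)
    then have "ad_ext q w y f = qclass q (ad_first q w y (\<Sum>n\<in>?N. ?t n))" for y
      by (simp only: ad qclass_finsum[OF True])
    then show ?thesis by blast
  next
    \<comment> \<open>A sum over an infinite index set is zero by convention, so the zero tensor represents it.\<close>
    case False
    then have "ad_ext q w y f = qclass q (ad_first q w y 0)" for y
      by (simp add: ad finsum_infinite ad_first_zero qclass_eq_zero rel_ideal_zero)
    then show ?thesis by blast
  qed
qed

theorem proposition23:
  fixes q w :: "'a::real_normed_field" and f :: "'a tensor set"
  assumes "q \<noteq> 0" and "qtwo q \<noteq> 0" and "w \<noteq> 0"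
    and "regular_couple (I_minus q) (I_plus q)"
    and "f \<in> carrier (qR3 q)"
  shows "qclass q (tscale (inverse q) tb) \<otimes>\<^bsub>qR3 q\<^esub> Cq q w f
       \<oplus>\<^bsub>qR3 q\<^esub> qclass q (tscale (1 / qtwo q) th) \<otimes>\<^bsub>qR3 q\<^esub> Hq q w f
       \<oplus>\<^bsub>qR3 q\<^esub> qclass q (tscale q tc) \<otimes>\<^bsub>qR3 q\<^esub> Bq q w f
       = \<zero>\<^bsub>qR3 q\<^esub>"
proof -
  obtain t where "\<And>y. ad_ext q w y f = qclass q (ad_first q w y t)"
    using ad_ext_common_representative by blast
  then show ?thesis
    by (simp add: Bq_def Hq_def Cq_def qclass_mult qclass_add qclass_eq_zero
        casimir_ad_first_in_rel_ideal[OF assms(1,2)])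
qed

end
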